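(* Let $\Sigma$ be an alphabet. Then for every $\Sigma$-algorithm process $\langle X\mid S\rangle$ there exists a $\Sigma$-algorithm graph $G$, unique up to isomorphism, such that $\langle X\mid S\rangle$ and $\mathrm{gr2pr}_\Sigma(G)$ are identical up to consistent renaming of (recursion) variables.
   Context: An alphabet is a pair $\Sigma=(F,P)$ of disjoint countable sets with distinguished $\mathsf{ini},\mathsf{fin}\in F$; $\widetilde F=F\setminus\{\mathsf{ini},\mathsf{fin}\}$. A rooted labeled directed graph is $(V,E,L_v,L_e,l,r)$ with $V$ nonempty finite, $E\subseteq V\times V$, $L_v,L_e$ countable, $l$ a partial function from $V\cup E$ to $L_v\cup L_e$ mapping vertices into $L_v$ and edges into $L_e$, $r\in V$; indegree/outdegree count in/out-neighbours; a cycle is $v_1\ldots v_{n+1}$ with $(v_i,v_{i+1})\in E$, $v_1,\dots,v_n$ distinct, $v_1=v_{n+1}$. A $\Sigma$-algorithm graph is such a graph with $L_v=F\cup P$, $L_e=\{0,1\}$, such that for every vertex $v$: $l(v)=\mathsf{ini}$ iff $v=r$; if $l(v)=\mathsf{ini}$: indegree $0$, outdegree $1$, outgoing edge unlabeled; if $l(v)=\mathsf{fin}$: indegree $>0$, outdegree $0$; if $l(v)\in\widetilde F$: indegree $>0$, outdegree $1$, outgoing edge unlabeled; if $l(v)\in P$: indegree $>0$, outdegree $2$, both outgoing edges labeled with different labels; every cycle contains a vertex labeled by an element of $F$. Two $\Sigma$-algorithm graphs $G=(V,E,L_v,L_e,l,r)$, $G'=(V',E',L_v,L_e,l',r')$ are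 isomorphic if there exist bijections $\beta_F:F\to F$, $\beta_P:P\to P$, $\beta_V:V\to V'$, $\beta_B:\{0,1\}\to\{0,1\}$ with $\beta_F(\mathsf{ini})=\mathsf{ini}$, $\beta_F(\mathsf{fin})=\mathsf{fin}$, $(v,v')\in E\iff(\beta_V(v),\beta_V(v'))\in E'$, $\beta_F(l(v))=l'(\beta_V(v))$ when $l(v)\in F$, $\beta_P(l(v))=l'(\beta_V(v))$ when $l(v)\in P$, and $\beta_B(l((v,v')))=l'((\beta_V(v),\beta_V(v')))$ whenever $(v,v')\in E$ and $l((v,v'))$ is defined. Process syntax: fix a symbol $\mathrm{MEM}$ (a flexible variable), a countably infinite set $\mathcal X$ of recursion variables, the condition constant $\mathsf{True}$, guarded command $\phi :\to t$, assignment $\mathrm{MEM}:=e$, sequential composition $\cdot$, alternative composition $+$, and the empty process $\epsilon$. A recursive specification $S$ is a set of equations $Y=t_Y$, and $\mathrm{vars}(S)$ is the set of recursion variables occurring in $S$; for $X\in\mathrm{vars}(S)$, $\langle X\mid S\rangle$ is a constant. A $\Sigma$-algorithm process is a constant $\langle X\mid S\rangle$ where $S$ is finite, a distinguished variable $X_\epsilon\in\mathrm{vars}(S)$, and for each $Y\in\mathrm{vars}(S)$ the equation for $Y$ in $S$ has one of the forms (1) $Y=\mathsf{True}:\to \mathrm{MEM}:=\mathsf{ini}(\mathrm{MEM})\cdot Z$; (2) $Y=\mathsf{True}:\to \mathrm{MEM}:=o(\mathrm{MEM})\cdot Z$; (3) $Y=(p(\mathrm{MEM})=1):\to \mathrm{MEM}:=\mathrm{MEM}\cdot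 Z + (p(\mathrm{MEM})=0):\to \mathrm{MEM}:=\mathrm{MEM}\cdot Z'$; (4) $Y=\mathsf{True}:\to \mathrm{MEM}:=\mathsf{fin}(\mathrm{MEM})\cdot X_\epsilon$; (5) $Y=\mathsf{True}:\to\epsilon$; with $o\in\widetilde F$, $p\in P$, $Z,Z'\in\mathrm{vars}(S)\setminus\{X_\epsilon\}$; the equation for $Y$ has form (1) iff $Y$ is $X$, and form (5) iff $Y$ is $X_\epsilon$. The graph-to-process function $\mathrm{gr2pr}_\Sigma$ maps a $\Sigma$-algorithm graph $G=(V,E,L_v,L_e,l,r)$ to the $\Sigma$-algorithm process $\langle X\mid S\rangle$, where pairwise distinct recursion variables $X_v$ ($v\in V$) are chosen and $S$ consists exactly of: $X=\mathsf{True}:\to\mathrm{MEM}:=\mathsf{ini}(\mathrm{MEM})\cdot X_{v'}$ where $(r,v')\in E$; $X_v=\mathsf{True}:\to\mathrm{MEM}:=o(\mathrm{MEM})\cdot X_{v'}$ for $v$ with $l(v)=o\in\widetilde F$, $(v,v')\in E$; $X_v=(p(\mathrm{MEM})=1):\to\mathrm{MEM}:=\mathrm{MEM}\cdot X_{v'}+(p(\mathrm{MEM})=0):\to\mathrm{MEM}:=\mathrm{MEM}\cdot X_{v''}$ for $v$ with $l(v)=p\in P$, $(v,v'),(v,v'')\in E$, $l((v,v'))=1$, $l((v,v''))=0$; $X_v=\mathsf{True}:\to\mathrm{MEM}:=\mathsf{fin}(\mathrm{MEM})\cdot X_\epsilon$ for $v$ with $l(v)=\mathsf{fin}$; and $X_\epsilon=\mathsf{True}:\to\epsilon$.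 ($\mathrm{gr2pr}_\Sigma$ is determined up to renaming of variables.)
   Formalization: Adds conditions without which no graph exists: X is on no right-hand side; each variable except X and X_ε is on some right-hand side; Z and Z' differ in form (3); no cycle of variables runs only through form (3) equations. Every vertex of a graph is taken to be labeled. *)

theory Defs
  imports "HOL-Library.Countable" "HOL-Library.Countable_Set" "HOL-Library.Infinite_Typeclass"
begin

record 'a alphabet =
  funs :: "'a set"
  preds :: "'a set"
  ini :: 'a
  fin :: 'a

definition alphabet :: "'a alphabet \<Rightarrow> bool" where
  "alphabet \<Sigma> \<longleftrightarrow>
     countable (funs \<Sigma>) \<and> countable (preds \<Sigma>) \<and> funs \<Sigma> \<inter> preds \<Sigma> = {} \<and>
     ini \<Sigma> \<in> funs \<Sigma> \<and> fin \<Sigma> \<in> funs \<Sigma> \<and> ini \<Sigma> \<noteq> fin \<Sigma>"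

definition proper_funs :: "'a alphabet \<Rightarrow> 'a set" where
  "proper_funs \<Sigma> = funs \<Sigma> - {ini \<Sigma>, fin \<Sigma>}"


(* The partial labelling function on vertices and edges is split into its restriction
   to vertices and its restriction to edges. *)
record ('v, 'a, 'b) rld_graph =
  verts :: "'v set"
  edges :: "('v \<times> 'v) set"
  vlabels :: "'a set"
  elabels :: "'b set"
  vlab :: "'v \<rightharpoonup> 'a"
  elab :: "'v \<times> 'v \<rightharpoonup> 'b"
  root :: 'v

definition rld_graph :: "('v, 'a, 'b) rld_graph \<Rightarrow> bool" where
  "rld_graph G \<longleftrightarrow>
     finite (verts G) \<and> verts G \<noteq> {} \<and> edges G \<subseteq> verts G \<times> verts G \<and>
     countable (vlabels G) \<and> countable (elabels G) \<and>
     dom (vlab G) \<subseteq> verts G \<and> ran (vlab G) \<subseteq> vlabels G \<and>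
     dom (elab G) \<subseteq> edges G \<and> ran (elab G) \<subseteq> elabels G \<and>
     root G \<in> verts G"

definition indegree :: "('v, 'a, 'b) rld_graph \<Rightarrow> 'v \<Rightarrow> nat" where
  "indegree G v = card {u. (u, v) \<in> edges G}"

definition outdegree :: "('v, 'a, 'b) rld_graph \<Rightarrow> 'v \<Rightarrow> nat" where
  "outdegree G v = card {w. (v, w) \<in> edges G}"

definition cycle :: "('v, 'a, 'b) rld_graph \<Rightarrow> 'v list \<Rightarrow> bool" where
  "cycle G vs \<longleftrightarrow>
     length vs \<ge> 2 \<and> (\<forall>i. Suc i < length vs \<longrightarrow> (vs ! i, vs ! Suc i) \<in> edges G) \<and>
     distinct (butlast vs) \<and> hd vs = last vs"

(* Every vertex is required to carry a label: the clauses below classify vertices by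
   their label and would say nothing about an unlabelled one. *)
definition algorithm_graph :: "'a alphabet \<Rightarrow> ('v, 'a, nat) rld_graph \<Rightarrow> bool" where
  "algorithm_graph \<Sigma> G \<longleftrightarrow>
     rld_graph G \<and> vlabels G = funs \<Sigma> \<union> preds \<Sigma> \<and> elabels G = {0, 1} \<and>
     (\<forall>v\<in>verts G. \<exists>s. vlab G v = Some s \<and>
        (s = ini \<Sigma> \<longleftrightarrow> v = root G) \<and>
        (s = ini \<Sigma> \<longrightarrow> indegree G v = 0 \<and> outdegree G v = 1 \<and>
           (\<forall>w. (v, w) \<in> edges G \<longrightarrow> elab G (v, w) = None)) \<and>
        (s = fin \<Sigma> \<longrightarrow> indegree G v > 0 \<and> outdegree G v = 0) \<and>
        (s \<in> proper_funs \<Sigma> \<longrightarrow> indegree G v > 0 \<and> outdegree G v = 1 \<and>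
           (\<forall>w. (v, w) \<in> edges G \<longrightarrow> elab G (v, w) = None)) \<and>
        (s \<in> preds \<Sigma> \<longrightarrow> indegree G v > 0 \<and> outdegree G v = 2 \<and>
           (\<forall>w. (v, w) \<in> edges G \<longrightarrow> elab G (v, w) \<noteq> None) \<and>
           (\<forall>w w'. (v, w) \<in> edges G \<and> (v, w') \<in> edges G \<and> w \<noteq> w' \<longrightarrow>
              elab G (v, w) \<noteq> elab G (v, w')))) \<and>
     (\<forall>vs. cycle G vs \<longrightarrow> (\<exists>v\<in>set vs. \<exists>f\<in>funs \<Sigma>. vlab G v = Some f))"

definition isomorphic ::
  "'a alphabet \<Rightarrow> ('v, 'a, nat) rld_graph \<Rightarrow> ('w, 'a, nat) rld_graph \<Rightarrow> bool" where
  "isomorphic \<Sigma> G G' \<longleftrightarrow>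
     (\<exists>\<beta>F \<beta>P \<beta>V \<beta>B.
        bij_betw \<beta>F (funs \<Sigma>) (funs \<Sigma>) \<and> bij_betw \<beta>P (preds \<Sigma>) (preds \<Sigma>) \<and>
        bij_betw \<beta>V (verts G) (verts G') \<and> bij_betw \<beta>B {0, 1::nat} {0, 1::nat} \<and>
        \<beta>F (ini \<Sigma>) = ini \<Sigma> \<and> \<beta>F (fin \<Sigma>) = fin \<Sigma> \<and>
        (\<forall>v\<in>verts G. \<forall>v'\<in>verts G. (v, v') \<in> edges G \<longleftrightarrow> (\<beta>V v, \<beta>V v') \<in> edges G') \<and>
        (\<forall>v\<in>verts G. \<forall>f\<in>funs \<Sigma>. vlab G v = Some f \<longrightarrow> vlab G' (\<beta>V v) = Some (\<beta>F f)) \<and>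
        (\<forall>v\<in>verts G. \<forall>p\<in>preds \<Sigma>. vlab G v = Some p \<longrightarrow> vlab G' (\<beta>V v) = Some (\<beta>P p)) \<and>
        (\<forall>v v' b. (v, v') \<in> edges G \<and> elab G (v, v') = Some b \<longrightarrow>
           elab G' (\<beta>V v, \<beta>V v') = Some (\<beta>B b)))"


datatype 'a dterm = MEM | App 'a "'a dterm"

datatype 'a cond = CTrue | CEq "'a dterm" nat

datatype ('a, rvars: 'x) pterm =
    Eps
  | Assign "'a dterm"  \<comment> \<open>assignment to \<open>MEM\<close>\<close>
  | Var 'x
  | Guarded "'a cond" "('a, 'x) pterm"
  | Seq "('a, 'x) pterm" "('a, 'x) pterm"
  | Alt "('a, 'x) pterm" "('a, 'x) pterm"

type_synonym ('a, 'x) spec = "('x \<times> ('a, 'x) pterm) set"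

(* The pair (X, S) stands for the recursion constant of X with respect to S. *)
type_synonym ('a, 'x) rconst = "'x \<times> ('a, 'x) spec"

definition vars :: "('a, 'x) spec \<Rightarrow> 'x set" where
  "vars S = (\<Union>(Y, t)\<in>S. insert Y (rvars t))"

definition recursive_spec :: "('a, 'x) spec \<Rightarrow> bool" where
  "recursive_spec S \<longleftrightarrow> (\<forall>Y\<in>vars S. \<exists>!t. (Y, t) \<in> S)"

definition fun_step :: "'a \<Rightarrow> 'x \<Rightarrow> ('a, 'x) pterm" where
  "fun_step f Z = Guarded CTrue (Seq (Assign (App f MEM)) (Var Z))"

definition pred_step :: "'a \<Rightarrow> 'x \<Rightarrow> 'x \<Rightarrow> ('a, 'x) pterm" where
  "pred_step p Z Z' =
     Alt (Guarded (CEq (App p MEM) 1) (Seq (Assign MEM) (Var Z)))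
         (Guarded (CEq (App p MEM) 0) (Seq (Assign MEM) (Var Z')))"

definition eps_step :: "('a, 'x) pterm" where
  "eps_step = Guarded CTrue Eps"

definition algorithm_process :: "'a alphabet \<Rightarrow> ('a, 'x) rconst \<Rightarrow> bool" where
  "algorithm_process \<Sigma> = (\<lambda>(X, S).
     recursive_spec S \<and> finite S \<and> X \<in> vars S \<and>
     (\<exists>Xe\<in>vars S. \<forall>(Y, t)\<in>S. let W = vars S - {Xe};
         form1 = (\<exists>Z\<in>W. t = fun_step (ini \<Sigma>) Z);
         form2 = (\<exists>f\<in>proper_funs \<Sigma>. \<exists>Z\<in>W. t = fun_step f Z);
         form3 = (\<exists>p\<in>preds \<Sigma>. \<exists>Z\<in>W. \<exists>Z'\<in>W. t = pred_step p Z Z');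
         form4 = (t = fun_step (fin \<Sigma>) Xe);
         form5 = (t = eps_step)
       in (form1 \<or> form2 \<or> form3 \<or> form4 \<or> form5) \<and>
          (form1 \<longleftrightarrow> Y = X) \<and> (form5 \<longleftrightarrow> Y = Xe)))"

definition rename_eq :: "('a, 'x) rconst \<Rightarrow> ('a, 'x) rconst \<Rightarrow> bool" where
  "rename_eq = (\<lambda>(X, S) (X', S'). \<exists>\<rho>. inj_on \<rho> (insert X (vars S)) \<and>
     X' = \<rho> X \<and> S' = (\<lambda>(Y, t). (\<rho> Y, map_pterm id \<rho> t)) ` S)"


(* The construction of a process from a graph, relative to a choice of variables:
   \<xi> v for each vertex v, and Xe for the variable of the empty process. *)
definition gr2pr_spec ::
  "'a alphabet \<Rightarrow> ('v, 'a, nat) rld_graph \<Rightarrow> ('v \<Rightarrow> 'x) \<Rightarrow> 'x \<Rightarrow> ('a, 'x) spec" where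
  "gr2pr_spec \<Sigma> G \<xi> Xe =
     {(\<xi> (root G), fun_step (ini \<Sigma>) (\<xi> v')) | v'. (root G, v') \<in> edges G} \<union>
     {(\<xi> v, fun_step f (\<xi> v')) | v v' f.
        v \<in> verts G \<and> vlab G v = Some f \<and> f \<in> proper_funs \<Sigma> \<and> (v, v') \<in> edges G} \<union>
     {(\<xi> v, pred_step p (\<xi> v') (\<xi> v'')) | v v' v'' p.
        v \<in> verts G \<and> vlab G v = Some p \<and> p \<in> preds \<Sigma> \<and>
        (v, v') \<in> edges G \<and> (v, v'') \<in> edges G \<and>
        elab G (v, v') = Some 1 \<and> elab G (v, v'') = Some 0} \<union>
     {(\<xi> v, fun_step (fin \<Sigma>) Xe) | v. v \<in> verts G \<and> vlab G v = Some (fin \<Sigma>)} \<union>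
     {(Xe, eps_step)}"

definition var_choice :: "('v, 'a, nat) rld_graph \<Rightarrow> ('v \<Rightarrow> 'x) \<times> 'x \<Rightarrow> bool" where
  "var_choice G = (\<lambda>(\<xi>, Xe). inj_on \<xi> (verts G) \<and> Xe \<notin> \<xi> ` verts G)"

definition gr2pr :: "'a alphabet \<Rightarrow> ('v, 'a, nat) rld_graph \<Rightarrow> ('a, 'x) rconst" where
  "gr2pr \<Sigma> G =
     (let (\<xi>, Xe) = (SOME c. var_choice G c) in (\<xi> (root G), gr2pr_spec \<Sigma> G \<xi> Xe))"

end

theory Submission
  imports Defs
begin

text \<open>
  A graph is recovered from its process: the variables other than \<open>X\<^sub>\<epsilon>\<close> are the vertices, the edges
  are the calls of variables on right-hand sides, and the labels are the function and predicate
  symbols there. For every choice of variables, each part of a graph can therefore be read off its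
  specification, so two graphs with the same specification are isomorphic.
  A renaming between a process and \<open>gr2pr \<Sigma> G\<close> can be absorbed into the choice of variables, which
  reduces equality up to renaming to equality.
\<close>

text \<open>The equation forms alone do not guarantee that the recovered graph is an algorithm
  graph. They allow an equation to call \<open>X\<close>, a variable that no equation calls, a test
  whose two branches continue with the same variable, and a loop that runs through tests only. The
  four hypotheses on calls exclude these cases. They correspond to the root having indegree 0, all
  other vertices having positive indegree, predicate vertices having outdegree 2 (edges form a set,
  so two calls of one variable would merge), and every cycle containing a function symbol. The other
  obstacle is that \<open>gr2pr\<close> picks its variables by Hilbert choice: all that is known of
  them is that they are distinct. This is why everything is proved for arbitrary
  \<open>\<xi>\<close> and \<open>Xe\<close>.\<close>

lemma step_simps [simp]:
  "fun_step f Z = fun_step g Z' \<longleftrightarrow> f = g \<and> Z = Z'"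
  "pred_step p Z1 Z2 = pred_step q Z1' Z2' \<longleftrightarrow> p = q \<and> Z1 = Z1' \<and> Z2 = Z2'"
  "fun_step f Z \<noteq> pred_step q Z1 Z2" "pred_step q Z1 Z2 \<noteq> fun_step f Z"
  "fun_step f Z \<noteq> eps_step" "eps_step \<noteq> fun_step f Z"
  "pred_step p Z1 Z2 \<noteq> eps_step" "eps_step \<noteq> pred_step p Z1 Z2"
  "rvars (fun_step f Z) = {Z}"
  "rvars (pred_step p Z1 Z2) = {Z1, Z2}"
  "rvars eps_step = {}"
  "map_pterm id h (fun_step f Z) = fun_step f (h Z)"
  "map_pterm id h (pred_step p Z1 Z2) = pred_step p (h Z1) (h Z2)"
  "map_pterm id h eps_step = eps_step"
  by (auto simp: fun_step_def pred_step_def eps_step_def dterm.map_id0 cond.map_id0)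

section \<open>Renaming the variables of a specification\<close>

definition rename_spec :: "('x \<Rightarrow> 'y) \<Rightarrow> ('a, 'x) spec \<Rightarrow> ('a, 'y) spec" where
  "rename_spec h S = (\<lambda>(Y, t). (h Y, map_pterm id h t)) ` S"

lemma rename_spec_comp: "rename_spec g (rename_spec h S) = rename_spec (g \<circ> h) S"
  by (force simp: rename_spec_def image_image pterm.map_comp case_prod_unfold)

lemma rename_spec_id:
  assumes "\<And>Y. Y \<in> vars S \<Longrightarrow> h Y = Y"
  shows "rename_spec h S = S"
proof -
  have "(h Y, map_pterm id h t) = (Y, t)" if "(Y, t) \<in> S" for Y t
  proof -
    have "Y \<in> vars S" "rvars t \<subseteq> vars S"
      using that by (auto simp: vars_def)
    then have "map_pterm id h t = map_pterm id id t"
      using assms by (intro pterm.map_cong) auto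
    then show ?thesis
      using assms \<open>Y \<in> vars S\<close> by (simp add: pterm.map_id)
  qed
  then show ?thesis
    by (force simp: rename_spec_def image_iff)
qed

lemma vars_rename_spec: "vars (rename_spec h S) = h ` vars S"
  by (simp add: vars_def rename_spec_def pterm.set_map image_UN case_prod_unfold)

lemma rename_eq_iff:
  "rename_eq (X, S) (X', S') \<longleftrightarrow>
     (\<exists>h. inj_on h (insert X (vars S)) \<and> X' = h X \<and> S' = rename_spec h S)"
  by (simp add: rename_eq_def rename_spec_def)

section \<open>The specification of a graph and the choice of its variables\<close>

lemma gr2pr_specI:
  "(root G, w) \<in> edges G \<Longrightarrow> (\<xi> (root G), fun_step (ini \<Sigma>) (\<xi> w)) \<in> gr2pr_spec \<Sigma> G \<xi> Xe"
  "v \<in> verts G \<Longrightarrow> vlab G v = Some f \<Longrightarrow> f \<in> proper_funs \<Sigma> \<Longrightarrow> (v, w) \<in> edges G \<Longrightarrow>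
     (\<xi> v, fun_step f (\<xi> w)) \<in> gr2pr_spec \<Sigma> G \<xi> Xe"
  "v \<in> verts G \<Longrightarrow> vlab G v = Some p \<Longrightarrow> p \<in> preds \<Sigma> \<Longrightarrow>
     (v, w) \<in> edges G \<Longrightarrow> (v, w') \<in> edges G \<Longrightarrow>
     elab G (v, w) = Some 1 \<Longrightarrow> elab G (v, w') = Some 0 \<Longrightarrow>
     (\<xi> v, pred_step p (\<xi> w) (\<xi> w')) \<in> gr2pr_spec \<Sigma> G \<xi> Xe"
  "v \<in> verts G \<Longrightarrow> vlab G v = Some (fin \<Sigma>) \<Longrightarrow>
     (\<xi> v, fun_step (fin \<Sigma>) Xe) \<in> gr2pr_spec \<Sigma> G \<xi> Xe"
  "(Xe, eps_step) \<in> gr2pr_spec \<Sigma> G \<xi> Xe"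
  unfolding gr2pr_spec_def by blast+

lemma gr2pr_spec_cases:
  assumes "(Y, t) \<in> gr2pr_spec \<Sigma> G \<xi> Xe"
  obtains
    (ini) w where "Y = \<xi> (root G)" "t = fun_step (ini \<Sigma>) (\<xi> w)" "(root G, w) \<in> edges G"
  | (proper) v w f where "Y = \<xi> v" "t = fun_step f (\<xi> w)"
      "v \<in> verts G" "vlab G v = Some f" "f \<in> proper_funs \<Sigma>" "(v, w) \<in> edges G"
  | (pred) v w w' p where "Y = \<xi> v" "t = pred_step p (\<xi> w) (\<xi> w')"
      "v \<in> verts G" "vlab G v = Some p" "p \<in> preds \<Sigma>" "(v, w) \<in> edges G" "(v, w') \<in> edges G"
      "elab G (v, w) = Some 1" "elab G (v, w') = Some 0"
  | (fin) v where "Y = \<xi> v" "t = fun_step (fin \<Sigma>) Xe" "v \<in> verts G" "vlab G v = Some (fin \<Sigma>)"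
  | (eps) "Y = Xe" "t = eps_step"
  using assms unfolding gr2pr_spec_def by blast

text \<open>The construction never inspects a variable: variables enter only through
  \<open>\<xi>\<close> and \<open>Xe\<close>. Renaming the result is therefore just another choice,
  separately in each of the five sets of equations.\<close>

lemma rename_spec_gr2pr_spec:
  "rename_spec h (gr2pr_spec \<Sigma> G \<xi> Xe) = gr2pr_spec \<Sigma> G (h \<circ> \<xi>) (h Xe)"
  unfolding rename_spec_def gr2pr_spec_def image_Un
  by (intro arg_cong2[where f = "(\<union>)"]) (force simp: image_iff)+

text \<open>Infinity of the variable type is used twice: for as many names as there are vertices,
  and for one spare name outside them.\<close>

lemma var_choice_exists:
  assumes "finite (verts G)"
  shows "\<exists>c :: ('v \<Rightarrow> 'x :: infinite) \<times> 'x. var_choice G c"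
proof -
  obtain A :: "'x set" where A: "finite A" "card A = card (verts G)"
    using infinite_arbitrarily_large infinite_UNIV by blast
  then obtain \<xi> where "bij_betw \<xi> (verts G) A"
    using assms finite_same_card_bij by metis
  moreover obtain Xe where "Xe \<notin> A"
    using ex_new_if_finite[OF infinite_UNIV A(1)] by blast
  ultimately show ?thesis
    by (intro exI[of _ "(\<xi>, Xe)"]) (auto simp: var_choice_def bij_betw_def)
qed

text \<open>Confines the Hilbert choice to one place; from here on only the validity of the chosen
  variables is used.\<close>

lemma gr2pr_obtain:
  fixes G :: "('v, 'a, nat) rld_graph"
  assumes "finite (verts G)"
  obtains \<xi> :: "'v \<Rightarrow> 'x :: infinite" and Xe where
    "var_choice G (\<xi>, Xe)" "gr2pr \<Sigma> G = (\<xi> (root G), gr2pr_spec \<Sigma> G \<xi> Xe)"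
proof -
  obtain \<xi> :: "'v \<Rightarrow> 'x" and Xe where c: "(SOME c. var_choice G c) = (\<xi>, Xe)"
    by (cases "SOME c :: ('v \<Rightarrow> 'x) \<times> 'x. var_choice G c")
  have "var_choice G (SOME c :: ('v \<Rightarrow> 'x) \<times> 'x. var_choice G c)"
    using var_choice_exists[OF assms] by (elim exE) (rule someI)
  then have "var_choice G (\<xi>, Xe)"
    unfolding c .
  with c show thesis
    by (intro that[of \<xi> Xe]) (simp_all only: gr2pr_def Let_def prod.case)
qed

section \<open>Reading an algorithm graph off its specification\<close>

locale alg_graph =
  fixes \<Sigma> :: "'a alphabet" and G :: "('v, 'a, nat) rld_graph"
  assumes alphabet: "alphabet \<Sigma>" and algorithm_graph: "algorithm_graph \<Sigma> G"
begin

lemma rld_graph: "rld_graph G"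
  using algorithm_graph unfolding algorithm_graph_def by (rule conjunct1)

lemma vlab_range: "vlab G v = Some s \<Longrightarrow> s \<in> funs \<Sigma> \<union> preds \<Sigma>"
proof -
  assume "vlab G v = Some s"
  then have "s \<in> ran (vlab G)" by (rule ranI)
  moreover have "ran (vlab G) \<subseteq> vlabels G"
    using rld_graph by (simp add: rld_graph_def)
  moreover have "vlabels G = funs \<Sigma> \<union> preds \<Sigma>"
    using algorithm_graph unfolding algorithm_graph_def by (elim conjE)
  ultimately show ?thesis by blast
qed

lemma elabels: "elabels G = {0, 1}"
  using algorithm_graph unfolding algorithm_graph_def by (elim conjE)

lemma finite_verts: "finite (verts G)"
  and root_vert: "root G \<in> verts G"
  using rld_graph by (simp_all add: rld_graph_def)

lemma edges_verts: "(v, w) \<in> edges G \<Longrightarrow> v \<in> verts G \<and> w \<in> verts G"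
  using rld_graph unfolding rld_graph_def by blast

lemma elab_range:
  assumes "elab G e = Some b"
  shows "e \<in> edges G \<and> b \<in> {0, 1}"
proof -
  have "e \<in> dom (elab G)" "b \<in> ran (elab G)"
    using assms by (auto intro: ranI)
  then show ?thesis
    using rld_graph unfolding rld_graph_def elabels by blast
qed

lemma alphabet_simps:
  "ini \<Sigma> \<in> funs \<Sigma>" "fin \<Sigma> \<in> funs \<Sigma>" "ini \<Sigma> \<noteq> fin \<Sigma>" "ini \<Sigma> \<notin> preds \<Sigma>" "fin \<Sigma> \<notin> preds \<Sigma>"
  "ini \<Sigma> \<notin> proper_funs \<Sigma>" "fin \<Sigma> \<notin> proper_funs \<Sigma>"
  "f \<in> proper_funs \<Sigma> \<Longrightarrow> f \<in> funs \<Sigma>" "f \<in> proper_funs \<Sigma> \<Longrightarrow> f \<notin> preds \<Sigma>"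
  "f \<in> funs \<Sigma> \<Longrightarrow> f = ini \<Sigma> \<or> f = fin \<Sigma> \<or> f \<in> proper_funs \<Sigma>"
  "f \<in> funs \<Sigma> \<Longrightarrow> f \<notin> preds \<Sigma>"
  using alphabet by (auto simp: alphabet_def proper_funs_def)

lemma vertex_label:
  assumes "v \<in> verts G"
  obtains s where "vlab G v = Some s" "s = ini \<Sigma> \<longleftrightarrow> v = root G"
    "s = ini \<Sigma> \<longrightarrow> indegree G v = 0 \<and> outdegree G v = 1 \<and>
       (\<forall>w. (v, w) \<in> edges G \<longrightarrow> elab G (v, w) = None)"
    "s = fin \<Sigma> \<longrightarrow> indegree G v > 0 \<and> outdegree G v = 0"
    "s \<in> proper_funs \<Sigma> \<longrightarrow> indegree G v > 0 \<and> outdegree G v = 1 \<and>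
       (\<forall>w. (v, w) \<in> edges G \<longrightarrow> elab G (v, w) = None)"
    "s \<in> preds \<Sigma> \<longrightarrow> indegree G v > 0 \<and> outdegree G v = 2 \<and>
       (\<forall>w. (v, w) \<in> edges G \<longrightarrow> elab G (v, w) \<noteq> None) \<and>
       (\<forall>w w'. (v, w) \<in> edges G \<and> (v, w') \<in> edges G \<and> w \<noteq> w' \<longrightarrow>
          elab G (v, w) \<noteq> elab G (v, w'))"
  using bspec[OF algorithm_graph[unfolded algorithm_graph_def, THEN conjunct2, THEN conjunct2,
        THEN conjunct2, THEN conjunct1] assms]
  by (elim exE conjE) (rule that)

text \<open>Only predicate vertices remain: edges leaving \<open>ini\<close> or a proper function
  symbol are unlabelled, and nothing leaves \<open>fin\<close>.\<close>

lemma elab_pred: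
  assumes "elab G (v, w) = Some b"
  obtains p where "vlab G v = Some p" "p \<in> preds \<Sigma>"
proof -
  have e: "(v, w) \<in> edges G" and v: "v \<in> verts G"
    using assms elab_range edges_verts by blast+
  obtain s where s: "vlab G v = Some s"
      "s = ini \<Sigma> \<Longrightarrow> elab G (v, w) = None" "s = fin \<Sigma> \<Longrightarrow> outdegree G v = 0"
      "s \<in> proper_funs \<Sigma> \<Longrightarrow> elab G (v, w) = None"
    by (rule vertex_label[OF v]) (use e in simp)
  \<comment> \<open>\<open>card\<close> is also 0 on infinite sets, so the presence of an edge
    contradicts outdegree 0 only once the successors are known to be finitely many.\<close>
  have "finite {w. (v, w) \<in> edges G}"
    using edges_verts by (intro finite_subset[OF _ finite_verts]) auto
  with e have "outdegree G v \<noteq> 0"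
    by (auto simp: outdegree_def)
  moreover have "s \<in> funs \<Sigma> \<union> preds \<Sigma>"
    using s(1) by (rule vlab_range)
  ultimately show thesis
    using s assms that alphabet_simps(10) by auto
qed

text \<open>Trades degree counts for explicit successor sets, the form in which
  \<open>gr2pr_spec\<close> consumes them. In the predicate case the successors are ordered by
  label, the one labelled 1 first, as in \<open>pred_step\<close>.\<close>

lemma vertex_cases:
  assumes "v \<in> verts G"
  obtains
    (ini) w where "v = root G" "vlab G v = Some (ini \<Sigma>)" "{w. (v, w) \<in> edges G} = {w}"
  | (proper) f w where "v \<noteq> root G" "vlab G v = Some f" "f \<in> proper_funs \<Sigma>"
      "{w. (v, w) \<in> edges G} = {w}"
  | (pred) p w w' where "v \<noteq> root G" "vlab G v = Some p" "p \<in> preds \<Sigma>"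
      "{w. (v, w) \<in> edges G} = {w, w'}" "elab G (v, w) = Some 1" "elab G (v, w') = Some 0"
  | (fin) "v \<noteq> root G" "vlab G v = Some (fin \<Sigma>)" "{w. (v, w) \<in> edges G} = {}"
proof -
  obtain s where s: "vlab G v = Some s" "s = ini \<Sigma> \<longleftrightarrow> v = root G"
      "s = ini \<Sigma> \<Longrightarrow> outdegree G v = 1" "s = fin \<Sigma> \<Longrightarrow> outdegree G v = 0"
      "s \<in> proper_funs \<Sigma> \<Longrightarrow> outdegree G v = 1"
      "s \<in> preds \<Sigma> \<Longrightarrow> outdegree G v = 2"
      "\<And>w. s \<in> preds \<Sigma> \<Longrightarrow> (v, w) \<in> edges G \<Longrightarrow> elab G (v, w) \<noteq> None"
      "\<And>w w'. s \<in> preds \<Sigma> \<Longrightarrow> (v, w) \<in> edges G \<Longrightarrow> (v, w') \<in> edges G \<Longrightarrow> w \<noteq> w' \<Longrightarrow>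
         elab G (v, w) \<noteq> elab G (v, w')"
    by (rule vertex_label[OF assms]) (auto simp del: not_None_eq)
  have fin: "finite {w. (v, w) \<in> edges G}"
    using edges_verts by (intro finite_subset[OF _ finite_verts]) auto
  have "s \<in> funs \<Sigma> \<union> preds \<Sigma>"
    using s(1) by (rule vlab_range)
  then consider "s = ini \<Sigma>" | "s = fin \<Sigma>" | "s \<in> proper_funs \<Sigma>" | "s \<in> preds \<Sigma>"
    using alphabet_simps(10) by blast
  then show thesis
  proof cases
    case 1
    then obtain w where "{w. (v, w) \<in> edges G} = {w}"
      using s(3) unfolding outdegree_def by (metis card_1_singletonE)
    with 1 s(1,2) show thesis by (intro that(1)) auto
  next
    case 2
    then have "{w. (v, w) \<in> edges G} = {}"
      using s(4) fin by (simp add: outdegree_def)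
    with 2 s(1,2) show thesis using alphabet_simps by (intro that(4)) auto
  next
    case 3
    then obtain w where "{w. (v, w) \<in> edges G} = {w}"
      using s(5) unfolding outdegree_def by (metis card_1_singletonE)
    with 3 s(1,2) show thesis using alphabet_simps by (intro that(2)) auto
  next
    case 4
    then obtain w w' where w: "{w. (v, w) \<in> edges G} = {w, w'}" "w \<noteq> w'"
      using s(6) unfolding outdegree_def by (metis card_2_iff)
    then have ww: "(v, w) \<in> edges G" "(v, w') \<in> edges G" by auto
    obtain b b' where b: "elab G (v, w) = Some b" "elab G (v, w') = Some b'" "b \<noteq> b'"
      using s(7)[OF 4 ww(1)] s(7)[OF 4 ww(2)] s(8)[OF 4 ww w(2)] by auto
    have "b \<in> {0, 1}" "b' \<in> {0, 1}"
      using b(1,2) elab_range by blast+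
    \<comment> \<open>Two different labels from \<open>{0, 1}\<close> are 1 and 0 in some order; in
      the second case the successors swap names.\<close>
    with b(3) consider "b = 1" "b' = 0" | "b = 0" "b' = 1" by auto
    moreover have "v \<noteq> root G"
      using s(2) 4 alphabet_simps(4) by auto
    moreover have "{w. (v, w) \<in> edges G} = {w', w}"
      using w(1) by auto
    ultimately show thesis
      using 4 s(1) b w(1) that(3) by metis
  qed
qed

text \<open>Bridges a gap in the construction: \<open>gr2pr_spec\<close> gives the
  \<open>ini\<close> equation to the root without consulting the label of the root.\<close>

lemma vlab_eq_ini_iff: "v \<in> verts G \<Longrightarrow> vlab G v = Some (ini \<Sigma>) \<longleftrightarrow> v = root G"
  by (erule vertex_cases) (use alphabet_simps in auto)

text \<open>Supplies at once that every vertex contributes its variable and that every edge shows up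
  as a call. It is an inclusion because the equation of a \<open>fin\<close> vertex mentions
  \<open>Xe\<close> although the vertex has no successor.\<close>

lemma rhs_exists:
  assumes "v \<in> verts G"
  shows "\<exists>t. (\<xi> v, t) \<in> gr2pr_spec \<Sigma> G \<xi> Xe \<and> \<xi> ` {w. (v, w) \<in> edges G} \<subseteq> rvars t"
  using assms
proof (cases rule: vertex_cases)
  case (ini w)
  then have "(root G, w) \<in> edges G" by auto
  from gr2pr_specI(1)[OF this, of \<xi> \<Sigma> Xe] ini show ?thesis
    by (intro exI[of _ "fun_step (ini \<Sigma>) (\<xi> w)"]) simp
next
  case (proper f w)
  then have "(v, w) \<in> edges G" by auto
  from gr2pr_specI(2)[OF assms proper(2,3) this, of \<xi> Xe] proper(4) show ?thesis
    by (intro exI[of _ "fun_step f (\<xi> w)"]) simp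
next
  case (pred p w w')
  then have "(v, w) \<in> edges G" "(v, w') \<in> edges G" by auto
  from gr2pr_specI(3)[OF assms pred(2,3) this pred(5,6), of \<xi> Xe] pred(4) show ?thesis
    by (intro exI[of _ "pred_step p (\<xi> w) (\<xi> w')"]) simp
next
  case fin
  from gr2pr_specI(4)[OF assms fin(2), of \<xi> Xe] fin(3) show ?thesis by blast
qed

lemma vars_gr2pr_spec: "vars (gr2pr_spec \<Sigma> G \<xi> Xe) = insert Xe (\<xi> ` verts G)"
proof
  show "vars (gr2pr_spec \<Sigma> G \<xi> Xe) \<subseteq> insert Xe (\<xi> ` verts G)"
  proof
    fix Z assume "Z \<in> vars (gr2pr_spec \<Sigma> G \<xi> Xe)"
    then obtain Y t where "(Y, t) \<in> gr2pr_spec \<Sigma> G \<xi> Xe" "Z \<in> insert Y (rvars t)"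
      by (auto simp: vars_def)
    then show "Z \<in> insert Xe (\<xi> ` verts G)"
      using root_vert by (cases rule: gr2pr_spec_cases) (auto dest: edges_verts)
  qed
  show "insert Xe (\<xi> ` verts G) \<subseteq> vars (gr2pr_spec \<Sigma> G \<xi> Xe)"
    using rhs_exists[of _ \<xi> Xe] gr2pr_specI(5)[of Xe \<Sigma> G \<xi>] unfolding vars_def by blast
qed

context
  fixes \<xi> :: "'v \<Rightarrow> 'x" and Xe :: 'x
  assumes choice: "var_choice G (\<xi>, Xe)"
begin

lemma choice_simps:
  "v \<in> verts G \<Longrightarrow> w \<in> verts G \<Longrightarrow> \<xi> v = \<xi> w \<longleftrightarrow> v = w"
  "v \<in> verts G \<Longrightarrow> \<xi> v \<noteq> Xe" "v \<in> verts G \<Longrightarrow> Xe \<noteq> \<xi> v"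
  using choice by (auto simp: var_choice_def inj_on_def)

text \<open>From a call back to an edge, injectivity of \<open>\<xi>\<close> identifies the vertices
  behind the two variables. Since \<open>Xe\<close> is no vertex variable, the call made by a
  \<open>fin\<close> vertex cannot be mistaken for an edge.\<close>

lemma edge_iff_spec:
  assumes "v \<in> verts G" "w \<in> verts G"
  shows "(v, w) \<in> edges G \<longleftrightarrow> (\<exists>t. (\<xi> v, t) \<in> gr2pr_spec \<Sigma> G \<xi> Xe \<and> \<xi> w \<in> rvars t)"
proof
  assume "(v, w) \<in> edges G"
  then show "\<exists>t. (\<xi> v, t) \<in> gr2pr_spec \<Sigma> G \<xi> Xe \<and> \<xi> w \<in> rvars t"
    using rhs_exists[OF assms(1), of \<xi> Xe] by blast
next
  assume "\<exists>t. (\<xi> v, t) \<in> gr2pr_spec \<Sigma> G \<xi> Xe \<and> \<xi> w \<in> rvars t"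
  then obtain t where "(\<xi> v, t) \<in> gr2pr_spec \<Sigma> G \<xi> Xe" "\<xi> w \<in> rvars t" by blast
  then show "(v, w) \<in> edges G"
    by (cases rule: gr2pr_spec_cases)
      (use assms root_vert edges_verts in \<open>auto simp: choice_simps\<close>)
qed

lemma vlab_fun_iff_spec:
  assumes "v \<in> verts G" "f \<in> funs \<Sigma>"
  shows "vlab G v = Some f \<longleftrightarrow> (\<exists>Z. (\<xi> v, fun_step f Z) \<in> gr2pr_spec \<Sigma> G \<xi> Xe)"
proof
  assume f: "vlab G v = Some f"
  show "\<exists>Z. (\<xi> v, fun_step f Z) \<in> gr2pr_spec \<Sigma> G \<xi> Xe"
    using assms(1)
  proof (cases rule: vertex_cases)
    case (ini w)
    then have "(root G, w) \<in> edges G" by auto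
    from gr2pr_specI(1)[OF this, of \<xi> \<Sigma> Xe] ini f show ?thesis by auto
  next
    case (proper g w)
    then have "(v, w) \<in> edges G" by auto
    from gr2pr_specI(2)[OF assms(1) proper(2,3) this, of \<xi> Xe] proper f show ?thesis by auto
  next
    case pred
    then show ?thesis using f assms(2) alphabet_simps(11) by simp
  next
    case fin
    from gr2pr_specI(4)[OF assms(1) fin(2), of \<xi> Xe] fin f show ?thesis by auto
  qed
next
  assume "\<exists>Z. (\<xi> v, fun_step f Z) \<in> gr2pr_spec \<Sigma> G \<xi> Xe"
  then obtain Z where "(\<xi> v, fun_step f Z) \<in> gr2pr_spec \<Sigma> G \<xi> Xe" ..
  then show "vlab G v = Some f"
    by (cases rule: gr2pr_spec_cases)
      (use assms root_vert vlab_eq_ini_iff[OF root_vert] in \<open>auto simp: choice_simps\<close>)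
qed

lemma vlab_pred_iff_spec:
  assumes "v \<in> verts G" "p \<in> preds \<Sigma>"
  shows "vlab G v = Some p \<longleftrightarrow> (\<exists>Z Z'. (\<xi> v, pred_step p Z Z') \<in> gr2pr_spec \<Sigma> G \<xi> Xe)"
proof
  assume p: "vlab G v = Some p"
  show "\<exists>Z Z'. (\<xi> v, pred_step p Z Z') \<in> gr2pr_spec \<Sigma> G \<xi> Xe"
    using assms(1)
  proof (cases rule: vertex_cases)
    case (pred q w w')
    then have "(v, w) \<in> edges G" "(v, w') \<in> edges G" by auto
    from gr2pr_specI(3)[OF assms(1) pred(2,3) this pred(5,6), of \<xi> Xe] pred(2) p show ?thesis by auto
  qed (use p assms(2) alphabet_simps in auto)
next
  assume "\<exists>Z Z'. (\<xi> v, pred_step p Z Z') \<in> gr2pr_spec \<Sigma> G \<xi> Xe"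
  then obtain Z Z' where "(\<xi> v, pred_step p Z Z') \<in> gr2pr_spec \<Sigma> G \<xi> Xe" by blast
  then show "vlab G v = Some p"
    by (cases rule: gr2pr_spec_cases) (use assms in \<open>auto simp: choice_simps\<close>)
qed

lemma elab_iff_spec:
  assumes "v \<in> verts G" "w \<in> verts G"
  shows "elab G (v, w) = Some b \<longleftrightarrow>
    (\<exists>p Z. b = 1 \<and> (\<xi> v, pred_step p (\<xi> w) Z) \<in> gr2pr_spec \<Sigma> G \<xi> Xe \<or>
           b = 0 \<and> (\<xi> v, pred_step p Z (\<xi> w)) \<in> gr2pr_spec \<Sigma> G \<xi> Xe)"
    (is "_ \<longleftrightarrow> ?R")
proof
  assume b: "elab G (v, w) = Some b"
  obtain q where q: "vlab G v = Some q" "q \<in> preds \<Sigma>"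
    using elab_pred[OF b] .
  have mem: "w \<in> {w. (v, w) \<in> edges G}"
    using elab_range[OF b] by simp
  show ?R using assms(1)
  proof (cases rule: vertex_cases)
    case (pred p w1 w0)
    then have "(v, w1) \<in> edges G" "(v, w0) \<in> edges G" by auto
    note gr2pr_specI(3)[OF assms(1) pred(2,3) this pred(5,6), of \<xi> Xe]
    moreover have "w = w1 \<and> b = 1 \<or> w = w0 \<and> b = 0"
      using mem b pred(5,6) unfolding pred(4) by auto
    ultimately show ?R by blast
  qed (use q alphabet_simps in auto)
next
  assume ?R
  then obtain p Z t where t: "(\<xi> v, t) \<in> gr2pr_spec \<Sigma> G \<xi> Xe"
      "b = 1 \<and> t = pred_step p (\<xi> w) Z \<or> b = 0 \<and> t = pred_step p Z (\<xi> w)"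
    by blast
  from t(1) show "elab G (v, w) = Some b"
    by (cases rule: gr2pr_spec_cases)
      (use t(2) assms edges_verts in \<open>auto simp: choice_simps\<close>)
qed

text \<open>Pins down \<open>Xe\<close> from the specification alone, so two choices with the same
  specification agree on it and hence on the set of vertex variables.\<close>

lemma eps_in_spec_iff: "(Y, eps_step) \<in> gr2pr_spec \<Sigma> G \<xi> Xe \<longleftrightarrow> Y = Xe"
  by (auto simp: gr2pr_spec_def)

end

text \<open>Edges stay inside \<open>verts G\<close>, so \<open>\<xi>\<close> is only ever evaluated
  at vertices.\<close>

lemma gr2pr_spec_cong:
  fixes \<xi> \<eta> :: "'v \<Rightarrow> 'x" and Xe :: 'x
  assumes "\<And>v. v \<in> verts G \<Longrightarrow> \<xi> v = \<eta> v"
  shows "gr2pr_spec \<Sigma> G \<xi> Xe = gr2pr_spec \<Sigma> G \<eta> Xe"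
proof -
  have "gr2pr_spec \<Sigma> G \<xi> Xe \<subseteq> gr2pr_spec \<Sigma> G \<eta> Xe"
    if eq: "\<And>v. v \<in> verts G \<Longrightarrow> \<xi> v = \<eta> v" for \<xi> \<eta> :: "'v \<Rightarrow> 'x"
  proof (rule subrelI)
    fix Y t assume "(Y, t) \<in> gr2pr_spec \<Sigma> G \<xi> Xe"
    then show "(Y, t) \<in> gr2pr_spec \<Sigma> G \<eta> Xe"
      by (cases rule: gr2pr_spec_cases)
        (use root_vert in \<open>simp_all add: gr2pr_specI eq edges_verts\<close>)
  qed
  then show ?thesis using assms by (metis subset_antisym)
qed

text \<open>Any two valid choices differ by an injective renaming: go back from a variable to its
  vertex along \<open>\<xi>\<close>, then forward along \<open>\<eta>\<close>, and send
  \<open>Xe\<close> to \<open>Ye\<close>. So it suffices to exhibit one convenient choice.\<close>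

lemma rename_eq_gr2pr:
  fixes \<xi> :: "'v \<Rightarrow> 'x :: infinite"
  assumes choice: "var_choice G (\<xi>, Xe)"
  shows "rename_eq (\<xi> (root G), gr2pr_spec \<Sigma> G \<xi> Xe) (gr2pr \<Sigma> G)"
proof -
  obtain \<eta> :: "'v \<Rightarrow> 'x" and Ye where
    \<eta>: "var_choice G (\<eta>, Ye)" "gr2pr \<Sigma> G = (\<eta> (root G), gr2pr_spec \<Sigma> G \<eta> Ye)"
    by (rule gr2pr_obtain[OF finite_verts])
  define h where "h = (\<lambda>Y. if Y = Xe then Ye else \<eta> (inv_into (verts G) \<xi> Y))"
  have inj: "inj_on \<xi> (verts G)"
    using choice by (simp add: var_choice_def)
  have h: "h (\<xi> v) = \<eta> v" if "v \<in> verts G" for v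
  proof -
    have "\<xi> v \<noteq> Xe"
      using choice that by (auto simp: var_choice_def)
    then show ?thesis
      by (simp only: h_def if_False inv_into_f_f[OF inj that])
  qed
  have h_Xe: "h Xe = Ye"
    by (simp add: h_def)
  have "inj_on h (\<xi> ` verts G)"
    using \<eta>(1) by (intro inj_onI) (auto simp: h var_choice_def dest: inj_onD)
  moreover have "Ye \<notin> h ` \<xi> ` verts G"
    using \<eta>(1) by (auto simp: h var_choice_def)
  ultimately have "inj_on h (insert Xe (\<xi> ` verts G))"
    by (auto simp: h_Xe)
  moreover have "insert (\<xi> (root G)) (vars (gr2pr_spec \<Sigma> G \<xi> Xe)) = insert Xe (\<xi> ` verts G)"
    using root_vert unfolding vars_gr2pr_spec by blast
  moreover have "rename_spec h (gr2pr_spec \<Sigma> G \<xi> Xe) = gr2pr_spec \<Sigma> G \<eta> Ye"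
    unfolding rename_spec_gr2pr_spec h_Xe by (rule gr2pr_spec_cong) (simp add: h)
  ultimately show ?thesis
    unfolding \<eta>(2) rename_eq_iff using h[OF root_vert] by metis
qed

text \<open>The renaming is injective on the variables of the process, so it can be undone there;
  composing the inverse with the choice made by \<open>gr2pr\<close> yields a choice that produces
  \<open>S\<close> literally.\<close>

lemma rename_eq_gr2prE:
  fixes X :: "'x :: infinite"
  assumes "rename_eq (X, S) (gr2pr \<Sigma> G)"
  obtains \<xi> Xe where "var_choice G (\<xi>, Xe)" "X = \<xi> (root G)" "S = gr2pr_spec \<Sigma> G \<xi> Xe"
proof -
  obtain \<eta> :: "'v \<Rightarrow> 'x" and Ye where
    \<eta>: "var_choice G (\<eta>, Ye)" "gr2pr \<Sigma> G = (\<eta> (root G), gr2pr_spec \<Sigma> G \<eta> Ye)"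
    by (rule gr2pr_obtain[OF finite_verts])
  obtain h where h: "inj_on h (insert X (vars S))" "\<eta> (root G) = h X"
      "gr2pr_spec \<Sigma> G \<eta> Ye = rename_spec h S"
    using assms unfolding \<eta>(2) rename_eq_iff by auto
  have img: "h ` vars S = insert Ye (\<eta> ` verts G)"
    using vars_gr2pr_spec[of \<eta> Ye] by (simp add: h(3) vars_rename_spec)
  define g where "g = inv_into (insert X (vars S)) h"
  have g: "g (h Y) = Y" if "Y \<in> insert X (vars S)" for Y
    using inv_into_f_f[OF h(1) that] by (simp add: g_def)
  have "inj_on g (insert Ye (\<eta> ` verts G))"
    unfolding img[symmetric] using g by (intro inj_onI) auto
  then have "var_choice G (g \<circ> \<eta>, g Ye)"
    using \<eta>(1) by (auto simp: var_choice_def inj_on_def)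
  moreover have "X = (g \<circ> \<eta>) (root G)"
    using g[of X] h(2) by simp
  moreover have "S = gr2pr_spec \<Sigma> G (g \<circ> \<eta>) (g Ye)"
    unfolding rename_spec_gr2pr_spec[symmetric] h(3) rename_spec_comp
    using g by (intro rename_spec_id[symmetric]) simp
  ultimately show thesis by (rule that)
qed

end

section \<open>Uniqueness of the graph\<close>

lemma isomorphic_if_same_spec:
  assumes G: "alg_graph \<Sigma> G" and G': "alg_graph \<Sigma> G'"
    and choice: "var_choice G (\<xi>, Xe)" and choice': "var_choice G' (\<xi>', Xe')"
    and eq: "gr2pr_spec \<Sigma> G \<xi> Xe = gr2pr_spec \<Sigma> G' \<xi>' Xe'"
  shows "isomorphic \<Sigma> G G'"
proof -
  interpret G: alg_graph \<Sigma> G by fact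
  interpret G': alg_graph \<Sigma> G' by fact
  have "Xe = Xe'"
    using G.eps_in_spec_iff[OF choice, of Xe'] G'.eps_in_spec_iff[OF choice', of Xe'] eq by simp
  then have img: "\<xi> ` verts G = \<xi>' ` verts G'"
    using G.vars_gr2pr_spec[of \<xi> Xe] G'.vars_gr2pr_spec[of \<xi>' Xe'] eq choice choice'
    by (auto simp: var_choice_def)
  \<comment> \<open>A vertex of \<open>G\<close> goes to the vertex of \<open>G'\<close> that
    carries the same variable.\<close>
  define \<beta> where "\<beta> = inv_into (verts G') \<xi>' \<circ> \<xi>"
  have "bij_betw \<xi> (verts G) (\<xi>' ` verts G')"
    using choice img by (auto simp: var_choice_def bij_betw_def)
  moreover have "bij_betw (inv_into (verts G') \<xi>') (\<xi>' ` verts G') (verts G')"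
    using choice' by (auto simp: var_choice_def intro!: bij_betw_inv_into inj_on_imp_bij_betw)
  ultimately have bij: "bij_betw \<beta> (verts G) (verts G')"
    unfolding \<beta>_def by (rule bij_betw_trans)
  have \<beta>: "\<beta> v \<in> verts G'" "\<xi>' (\<beta> v) = \<xi> v" if "v \<in> verts G" for v
    using that bij img by (auto simp: bij_betw_def \<beta>_def intro!: f_inv_into_f)
  show ?thesis
    unfolding isomorphic_def
  \<comment> \<open>Function symbols, predicate symbols and edge labels can be read from the common
    specification unchanged, so the identity serves for all three; only vertices are
    renamed.\<close>
  proof (intro exI[of _ id] exI[of _ \<beta>] conjI)
    show "\<forall>v\<in>verts G. \<forall>v'\<in>verts G. (v, v') \<in> edges G \<longleftrightarrow> (\<beta> v, \<beta> v') \<in> edges G'"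
      by (simp add: G.edge_iff_spec[OF choice] G'.edge_iff_spec[OF choice'] \<beta> eq)
    show "\<forall>v\<in>verts G. \<forall>f\<in>funs \<Sigma>. vlab G v = Some f \<longrightarrow> vlab G' (\<beta> v) = Some (id f)"
      by (simp add: G.vlab_fun_iff_spec[OF choice] G'.vlab_fun_iff_spec[OF choice'] \<beta> eq)
    show "\<forall>v\<in>verts G. \<forall>p\<in>preds \<Sigma>. vlab G v = Some p \<longrightarrow> vlab G' (\<beta> v) = Some (id p)"
      by (simp add: G.vlab_pred_iff_spec[OF choice] G'.vlab_pred_iff_spec[OF choice'] \<beta> eq)
    show "\<forall>v v' b. (v, v') \<in> edges G \<and> elab G (v, v') = Some b \<longrightarrow>
        elab G' (\<beta> v, \<beta> v') = Some (id b)"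
    proof (intro allI impI, elim conjE)
      fix v v' b assume "(v, v') \<in> edges G" "elab G (v, v') = Some b"
      moreover from this have "v \<in> verts G" "v' \<in> verts G"
        using G.edges_verts by auto
      ultimately show "elab G' (\<beta> v, \<beta> v') = Some (id b)"
        by (simp add: G.elab_iff_spec[OF choice] G'.elab_iff_spec[OF choice'] \<beta> eq)
    qed
  qed (use bij in auto)
qed

section \<open>The graph of a process\<close>

text \<open>\<open>fun_step\<close> and \<open>pred_step\<close> are not constructors, so their
  symbol is extracted by descending to the left through the term until a predicate guard or an
  assignment shows it.\<close>

fun symbol :: "('a, 'x) pterm \<Rightarrow> 'a option" where
  "symbol Eps = None"
| "symbol (Assign e) = (case e of MEM \<Rightarrow> None | App f _ \<Rightarrow> Some f)"
| "symbol (Var Z) = None"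
| "symbol (Guarded c t) = (case c of CEq (App p _) _ \<Rightarrow> Some p | _ \<Rightarrow> symbol t)"
| "symbol (Seq t u) = symbol t"
| "symbol (Alt t u) = symbol t"

lemma symbol_simps [simp]:
  "symbol (fun_step f Z) = Some f" "symbol (pred_step p Z Z') = Some p"
  by (simp_all add: fun_step_def pred_step_def)

text \<open>Variables are coded by \<open>to_nat\<close> so that the vertex type is
  \<open>nat\<close> for every variable type. Membership in \<open>V\<close> is checked throughout
  because \<open>from_nat\<close> is arbitrary on numbers that code nothing. \<open>elab\<close>
  tests the first branch before the second, which is harmless once the branches differ.\<close>

definition process_graph ::
  "'a alphabet \<Rightarrow> ('a, 'x :: countable) spec \<Rightarrow> 'x \<Rightarrow> 'x \<Rightarrow> (nat, 'a, nat) rld_graph" where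
  "process_graph \<Sigma> S X Xe = (let V = to_nat ` (vars S - {Xe}) in
     \<lparr>verts = V,
      edges = {(m, n). m \<in> V \<and> n \<in> V \<and> (\<exists>t. (from_nat m, t) \<in> S \<and> from_nat n \<in> rvars t)},
      vlabels = funs \<Sigma> \<union> preds \<Sigma>,
      elabels = {0, 1},
      vlab = (\<lambda>n. if n \<in> V then symbol (THE t. (from_nat n, t) \<in> S) else None),
      elab = (\<lambda>(m, n).
        if m \<in> V \<and> n \<in> V then
          if \<exists>p Z. (from_nat m, pred_step p (from_nat n) Z) \<in> S then Some 1
          else if \<exists>p Z. (from_nat m, pred_step p Z (from_nat n)) \<in> S then Some 0
          else None
        else None),
      root = to_nat X\<rparr>)"

lemma process_graph_sel [simp]:
  fixes S :: "('a, 'x :: countable) spec"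
  shows
    "verts (process_graph \<Sigma> S X Xe) = to_nat ` (vars S - {Xe})"
    "vlabels (process_graph \<Sigma> S X Xe) = funs \<Sigma> \<union> preds \<Sigma>"
    "elabels (process_graph \<Sigma> S X Xe) = {0, 1}"
    "root (process_graph \<Sigma> S X Xe) = to_nat X"
  by (simp_all add: process_graph_def Let_def)

text \<open>Unfolds \<open>algorithm_process\<close> for a fixed \<open>Xe\<close>, with the
  equivalence between form 1 and \<open>Y = X\<close> worked into the cases, and adds the conditions
  on calls under which \<open>process_graph\<close> is an algorithm graph.\<close>

locale called_process =
  fixes \<Sigma> :: "'a alphabet" and X :: "'x :: countable" and S :: "('a, 'x) spec" and Xe :: 'x
  assumes alphabet: "alphabet \<Sigma>"
    and unique: "\<And>Y. Y \<in> vars S \<Longrightarrow> \<exists>!t. (Y, t) \<in> S"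
    and finite: "finite S"
    and X_var: "X \<in> vars S" and Xe_var: "Xe \<in> vars S"
    and forms: "\<And>Y t. (Y, t) \<in> S \<Longrightarrow>
      (\<exists>Z\<in>vars S - {Xe}. Y = X \<and> t = fun_step (ini \<Sigma>) Z) \<or>
      (\<exists>f\<in>proper_funs \<Sigma>. \<exists>Z\<in>vars S - {Xe}. Y \<noteq> X \<and> t = fun_step f Z) \<or>
      (\<exists>p\<in>preds \<Sigma>. \<exists>Z\<in>vars S - {Xe}. \<exists>Z'\<in>vars S - {Xe}. Y \<noteq> X \<and> t = pred_step p Z Z') \<or>
      (Y \<noteq> X \<and> t = fun_step (fin \<Sigma>) Xe) \<or>
      (Y = Xe \<and> Y \<noteq> X \<and> t = eps_step)"
    and eps_step_Xe: "\<And>t. (Xe, t) \<in> S \<Longrightarrow> t = eps_step"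
    and root_not_called: "\<And>Y t. (Y, t) \<in> S \<Longrightarrow> X \<notin> rvars t"
    and others_called: "\<And>Y t. (Y, t) \<in> S \<Longrightarrow> Y \<noteq> X \<Longrightarrow> t \<noteq> eps_step \<Longrightarrow>
      \<exists>(W, u)\<in>S. Y \<in> rvars u"
    and branches_distinct: "\<And>Y p Z Z'. (Y, pred_step p Z Z') \<in> S \<Longrightarrow> Z \<noteq> Z'"
    and no_pred_cycle:
      "acyclic {(Y, Z). \<exists>p Z1 Z2. (Y, pred_step p Z1 Z2) \<in> S \<and> Z \<in> {Z1, Z2}}"
begin

abbreviation "G \<equiv> process_graph \<Sigma> S X Xe"

lemma rhs_unique: "(Y, t) \<in> S \<Longrightarrow> (Y, u) \<in> S \<Longrightarrow> t = u"
  using unique[of Y] by (auto simp: vars_def)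

lemma lhs_var: "(Y, t) \<in> S \<Longrightarrow> Y \<in> vars S"
  by (auto simp: vars_def)

lemma rhs_var: "(Y, t) \<in> S \<Longrightarrow> Z \<in> rvars t \<Longrightarrow> Z \<in> vars S"
  by (auto simp: vars_def)

lemma the_rhs: "(Y, t) \<in> S \<Longrightarrow> (THE t. (Y, t) \<in> S) = t"
  using rhs_unique by blast

lemma X_neq_Xe: "X \<noteq> Xe"
proof -
  obtain t where "(Xe, t) \<in> S"
    using unique[OF Xe_var] by blast
  then show ?thesis using forms eps_step_Xe by fastforce
qed

lemma finite_vars: "finite (vars S)"
proof -
  have "vars S \<subseteq> fst ` S"
    using unique by force
  then show ?thesis
    using finite finite_subset by blast
qed

lemma edge_iff:
  "(to_nat Y, to_nat Z) \<in> edges G \<longleftrightarrow> Y \<noteq> Xe \<and> Z \<noteq> Xe \<and> (\<exists>t. (Y, t) \<in> S \<and> Z \<in> rvars t)"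
  by (auto simp: process_graph_def Let_def inj_image_mem_iff dest: lhs_var rhs_var)

lemma edges_image: "edges G \<subseteq> to_nat ` (vars S - {Xe}) \<times> to_nat ` (vars S - {Xe})"
  by (auto simp: process_graph_def Let_def)

lemma edgeE:
  assumes "(m, n) \<in> edges G"
  obtains Y Z t where "m = to_nat Y" "n = to_nat Z" "Y \<noteq> Xe" "Z \<noteq> Xe" "(Y, t) \<in> S" "Z \<in> rvars t"
proof -
  have "(m, n) \<in> to_nat ` (vars S - {Xe}) \<times> to_nat ` (vars S - {Xe})"
    using edges_image assms by (rule subsetD)
  then obtain Y Z :: 'x where YZ: "m = to_nat Y" "n = to_nat Z" by blast
  then obtain t where "Y \<noteq> Xe" "Z \<noteq> Xe" "(Y, t) \<in> S" "Z \<in> rvars t"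
    using assms by (auto simp: edge_iff)
  with YZ show thesis by (rule that)
qed

lemma vlab_eq: "(Y, t) \<in> S \<Longrightarrow> Y \<noteq> Xe \<Longrightarrow> vlab G (to_nat Y) = symbol t"
  by (auto simp: process_graph_def Let_def the_rhs dest: lhs_var)

lemma elab_eq:
  assumes "Y \<noteq> Xe" "Z \<noteq> Xe"
  shows "elab G (to_nat Y, to_nat Z) =
    (if \<exists>p Z'. (Y, pred_step p Z Z') \<in> S then Some 1
     else if \<exists>p Z'. (Y, pred_step p Z' Z) \<in> S then Some 0 else None)"
  using assms by (auto simp: process_graph_def Let_def inj_image_mem_iff dest: lhs_var rhs_var)

lemma elab_pred_step:
  assumes S: "(Y, pred_step p Z Z') \<in> S" and neq: "Y \<noteq> Xe" "Z \<noteq> Xe" "Z' \<noteq> Xe"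
  shows "elab G (to_nat Y, to_nat Z) = Some 1" "elab G (to_nat Y, to_nat Z') = Some 0"
proof -
  show "elab G (to_nat Y, to_nat Z) = Some 1"
    unfolding elab_eq[OF neq(1,2)] using S by (intro if_P) blast
  \<comment> \<open>Label 0 is reached only if the test for label 1 fails. As \<open>Y\<close> has a
    single equation, that test could succeed for \<open>Z'\<close> only if both branches
    coincided.\<close>
  have "\<not> (\<exists>q Z1. (Y, pred_step q Z' Z1) \<in> S)"
    using rhs_unique[OF S] branches_distinct[OF S] by fastforce
  moreover have "\<exists>q Z1. (Y, pred_step q Z1 Z') \<in> S"
    using S by blast
  ultimately show "elab G (to_nat Y, to_nat Z') = Some 0"
    unfolding elab_eq[OF neq(1,3)] by (simp only: if_True if_False)
qed

text \<open>\<open>Xe\<close> is no vertex, and removing it is what leaves a \<open>fin\<close>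
  vertex with outdegree 0.\<close>

lemma successors_eq:
  assumes "(Y, t) \<in> S" "Y \<noteq> Xe"
  shows "{w. (to_nat Y, w) \<in> edges G} = to_nat ` (rvars t - {Xe})"
proof
  show "to_nat ` (rvars t - {Xe}) \<subseteq> {w. (to_nat Y, w) \<in> edges G}"
    using assms by (auto simp: edge_iff)
  show "{w. (to_nat Y, w) \<in> edges G} \<subseteq> to_nat ` (rvars t - {Xe})"
  proof
    fix w assume w: "w \<in> {w. (to_nat Y, w) \<in> edges G}"
    then obtain Z :: 'x where "w = to_nat Z" by (auto elim: edgeE)
    with w assms show "w \<in> to_nat ` (rvars t - {Xe})"
      by (auto simp: edge_iff dest: rhs_unique)
  qed
qed

lemma indegree_pos:
  assumes "(Y, t) \<in> S" "Y \<noteq> Xe" "Y \<noteq> X"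
  shows "indegree G (to_nat Y) > 0"
proof -
  have "t \<noteq> eps_step"
    using forms[OF assms(1)] assms(2) by auto
  then obtain W u where W: "(W, u) \<in> S" "Y \<in> rvars u"
    using others_called[OF assms(1,3)] by auto
  \<comment> \<open>The equation of \<open>Xe\<close> calls nothing, so the caller is a genuine
    vertex.\<close>
  have "W \<noteq> Xe" using W eps_step_Xe by fastforce
  with W assms(2) have "to_nat W \<in> {u. (u, to_nat Y) \<in> edges G}"
    by (auto simp: edge_iff)
  moreover have "finite {u. (u, to_nat Y) \<in> edges G}"
  proof (rule finite_subset)
    show "{u. (u, to_nat Y) \<in> edges G} \<subseteq> to_nat ` (vars S - {Xe})"
      using edges_image by blast
  qed (simp add: finite_vars)
  ultimately show ?thesis
    by (auto simp: indegree_def card_gt_0_iff)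
qed

lemma indegree_root: "indegree G (to_nat X) = 0"
proof -
  have "{u. (u, to_nat X) \<in> edges G} = {}"
    using root_not_called by (auto elim!: edgeE)
  then show ?thesis by (simp add: indegree_def)
qed

text \<open>Without a function symbol every vertex of the cycle stands for a test, so each of its
  edges lies in the relation assumed acyclic, and going round once relates a variable to
  itself.\<close>

lemma cycle_has_fun:
  assumes "cycle G vs"
  shows "\<exists>v\<in>set vs. \<exists>f\<in>funs \<Sigma>. vlab G v = Some f"
proof (rule ccontr)
  assume no_fun: "\<not> ?thesis"
  let ?R = "{(Y, Z). \<exists>p Z1 Z2. (Y, pred_step p Z1 Z2) \<in> S \<and> Z \<in> {Z1, Z2}}"
  have len: "length vs \<ge> 2" and edge: "\<And>i. Suc i < length vs \<Longrightarrow> (vs ! i, vs ! Suc i) \<in> edges G"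
    and closed: "hd vs = last vs"
    using assms by (auto simp: cycle_def)
  have step: "(from_nat (vs ! i), from_nat (vs ! Suc i)) \<in> ?R" if i: "Suc i < length vs" for i
  proof -
    obtain Y Z :: 'x where YZ: "vs ! i = to_nat Y" "vs ! Suc i = to_nat Z"
      using edge[OF i] by (rule edgeE)
    obtain t where t: "Y \<noteq> Xe" "Z \<noteq> Xe" "(Y, t) \<in> S" "Z \<in> rvars t"
      using edge[OF i] by (auto simp: YZ edge_iff)
    have "vs ! i \<in> set vs" using i by simp
    then have "symbol t \<notin> Some ` funs \<Sigma>"
      using no_fun vlab_eq[OF t(3,1)] YZ by auto
    then obtain p Z1 Z2 where "t = pred_step p Z1 Z2"
      using forms[OF t(3)] alphabet t(1) that by (auto simp: alphabet_def proper_funs_def)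
    with t(3,4) have "(Y, Z) \<in> ?R" by auto
    then show ?thesis by (simp only: YZ from_nat_to_nat)
  qed
  have "(from_nat (vs ! 0), from_nat (vs ! Suc i)) \<in> ?R\<^sup>+" if "Suc i < length vs" for i
    using that
  proof (induction i)
    case 0
    then show ?case using step[of 0] by (intro r_into_trancl) simp
  next
    case (Suc i)
    then show ?case using step[of "Suc i"] by (meson Suc_lessD trancl.trancl_into_trancl)
  qed
  \<comment> \<open>For this index \<open>Suc i\<close> is the last position of \<open>vs\<close>,
    whose entry equals the head.\<close>
  from this[of "length vs - 2"] have "(from_nat (hd vs), from_nat (last vs)) \<in> ?R\<^sup>+"
    using len by (cases vs) (auto simp: last_conv_nth Suc_diff_Suc numeral_2_eq_2)
  then show False
    using no_pred_cycle closed by (simp add: acyclic_def)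
qed

lemma rld_graph_process_graph: "rld_graph G"
proof -
  have "ran (vlab G) \<subseteq> funs \<Sigma> \<union> preds \<Sigma>"
  proof
    fix s assume "s \<in> ran (vlab G)"
    then obtain v where v: "vlab G v = Some s" by (auto simp: ran_def)
    then obtain Y where Y: "v = to_nat Y" "Y \<in> vars S" "Y \<noteq> Xe"
      by (auto simp: process_graph_def Let_def split: if_splits)
    obtain t where "(Y, t) \<in> S" using unique[OF Y(2)] by blast
    with v Y show "s \<in> funs \<Sigma> \<union> preds \<Sigma>"
      using forms[of Y t] alphabet vlab_eq[of Y t]
      by (auto simp: alphabet_def proper_funs_def)
  qed
  moreover have "dom (elab G) \<subseteq> edges G"
    by (auto simp: process_graph_def Let_def split: if_splits) force+
  moreover have "dom (vlab G) \<subseteq> verts G" "ran (elab G) \<subseteq> {0, 1}"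
    by (auto simp: process_graph_def Let_def ran_def split: if_splits)
  ultimately show ?thesis
    using alphabet edges_image finite_vars X_var X_neq_Xe
    by (auto simp: rld_graph_def alphabet_def)
qed

lemma algorithm_graph_process_graph: "algorithm_graph \<Sigma> G"
  unfolding algorithm_graph_def
proof (intro conjI ballI)
  fix v assume "v \<in> verts G"
  then obtain Y :: 'x where v: "v = to_nat Y" and Y: "Y \<in> vars S" "Y \<noteq> Xe" by auto
  obtain t where t: "(Y, t) \<in> S" using unique[OF Y(1)] by blast
  note succ = successors_eq[OF t Y(2)] and lab = vlab_eq[OF t Y(2)]
  have alph: "ini \<Sigma> \<in> funs \<Sigma>" "fin \<Sigma> \<in> funs \<Sigma>" "ini \<Sigma> \<noteq> fin \<Sigma>" "funs \<Sigma> \<inter> preds \<Sigma> = {}"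
    using alphabet by (auto simp: alphabet_def)
  have unlabelled: "elab G (to_nat Y, w) = None" if not_pred: "\<And>p Z Z'. t \<noteq> pred_step p Z Z'"
      and w: "(to_nat Y, w) \<in> edges G" for w
  proof -
    obtain Z :: 'x where Z: "w = to_nat Z" using w by (rule edgeE)
    have "Z \<noteq> Xe" using w by (simp add: Z edge_iff)
    moreover have "(Y, pred_step p Z1 Z2) \<notin> S" for p Z1 Z2
      using rhs_unique[OF t] not_pred by blast
    ultimately show ?thesis
      using Y(2) by (simp add: Z elab_eq)
  qed
  consider
      (ini) Z where "Y = X" "t = fun_step (ini \<Sigma>) Z" "Z \<noteq> Xe"
    | (proper) f Z where "Y \<noteq> X" "f \<in> proper_funs \<Sigma>" "t = fun_step f Z" "Z \<noteq> Xe"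
    | (pred) p Z Z' where "Y \<noteq> X" "p \<in> preds \<Sigma>" "t = pred_step p Z Z'" "Z \<noteq> Xe" "Z' \<noteq> Xe"
    | (fin) "Y \<noteq> X" "t = fun_step (fin \<Sigma>) Xe"
    using forms[OF t] Y(2) by blast
  then show "\<exists>s. vlab G v = Some s \<and>
        (s = ini \<Sigma> \<longleftrightarrow> v = root G) \<and>
        (s = ini \<Sigma> \<longrightarrow> indegree G v = 0 \<and> outdegree G v = 1 \<and>
           (\<forall>w. (v, w) \<in> edges G \<longrightarrow> elab G (v, w) = None)) \<and>
        (s = fin \<Sigma> \<longrightarrow> indegree G v > 0 \<and> outdegree G v = 0) \<and>
        (s \<in> proper_funs \<Sigma> \<longrightarrow> indegree G v > 0 \<and> outdegree G v = 1 \<and>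
           (\<forall>w. (v, w) \<in> edges G \<longrightarrow> elab G (v, w) = None)) \<and>
        (s \<in> preds \<Sigma> \<longrightarrow> indegree G v > 0 \<and> outdegree G v = 2 \<and>
           (\<forall>w. (v, w) \<in> edges G \<longrightarrow> elab G (v, w) \<noteq> None) \<and>
           (\<forall>w w'. (v, w) \<in> edges G \<and> (v, w') \<in> edges G \<and> w \<noteq> w' \<longrightarrow>
              elab G (v, w) \<noteq> elab G (v, w')))"
  proof cases
    case ini
    have "outdegree G v = 1"
      unfolding outdegree_def v succ using ini by simp
    moreover have "ini \<Sigma> \<notin> proper_funs \<Sigma>" "ini \<Sigma> \<notin> preds \<Sigma>"
      using alph by (auto simp: proper_funs_def)
    ultimately show ?thesis
      using ini lab alph unlabelled indegree_root by (simp add: v)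
  next
    case proper
    have "outdegree G v = 1"
      unfolding outdegree_def v succ using proper by simp
    moreover have "f \<noteq> ini \<Sigma>" "f \<noteq> fin \<Sigma>" "f \<notin> preds \<Sigma>"
      using proper(2) alph by (auto simp: proper_funs_def)
    ultimately show ?thesis
      using proper lab unlabelled indegree_pos[OF t Y(2) proper(1)] by (simp add: v)
  next
    case pred
    \<comment> \<open>With equal branches the two calls would be one edge and the outdegree only
      1.\<close>
    have neq: "Z \<noteq> Z'" using branches_distinct t pred(3) by blast
    have rv: "rvars t - {Xe} = {Z, Z'}" using pred by auto
    have "outdegree G v = 2"
      unfolding outdegree_def v succ rv using neq by simp
    moreover have "p \<noteq> ini \<Sigma>" "p \<noteq> fin \<Sigma>" "p \<notin> proper_funs \<Sigma>"
      using pred(2) alph unfolding proper_funs_def by blast+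
    moreover have "elab G (v, to_nat Z) = Some 1" "elab G (v, to_nat Z') = Some 0"
      unfolding v using elab_pred_step t pred Y(2) by metis+
    moreover have "(v, w) \<in> edges G \<longleftrightarrow> w = to_nat Z \<or> w = to_nat Z'" for w
      using succ unfolding v rv by blast
    moreover have "vlab G v = Some p" "indegree G v > 0" "v \<noteq> root G"
      using pred lab indegree_pos[OF t Y(2) pred(1)] by (simp_all add: v)
    ultimately show ?thesis
      using pred(2) by auto
  next
    case fin
    have "outdegree G v = 0"
      unfolding outdegree_def v succ using fin by simp
    moreover have "fin \<Sigma> \<notin> proper_funs \<Sigma>" "fin \<Sigma> \<notin> preds \<Sigma>"
      using alph by (auto simp: proper_funs_def)
    ultimately show ?thesis
      using fin lab alph indegree_pos[OF t Y(2) fin(1)] by (simp add: v)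
  qed
qed (use rld_graph_process_graph cycle_has_fun in auto)

text \<open>Decoding is injective on codes, and the code of \<open>Xe\<close> was kept out of the
  vertices; so the original variables are themselves a valid choice.\<close>

lemma var_choice_process_graph: "var_choice G (from_nat, Xe)"
  by (auto simp: var_choice_def inj_on_def)

text \<open>Naming each vertex by the variable it codes makes the round trip an equality rather than
  a renaming.\<close>

lemma gr2pr_spec_process_graph: "gr2pr_spec \<Sigma> G from_nat Xe = S"
proof (intro equalityI subrelI)
  fix Y t assume t: "(Y, t) \<in> S"
  have Y: "to_nat Y \<in> verts G" if "Y \<noteq> Xe" using lhs_var[OF t] that by auto
  note lab = vlab_eq[OF t]
  consider
      (ini) Z where "Y = X" "t = fun_step (ini \<Sigma>) Z" "Z \<noteq> Xe"
    | (proper) f Z where "Y \<noteq> Xe" "f \<in> proper_funs \<Sigma>" "t = fun_step f Z" "Z \<noteq> Xe"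
    | (pred) p Z Z' where "Y \<noteq> Xe" "p \<in> preds \<Sigma>" "t = pred_step p Z Z'" "Z \<noteq> Xe" "Z' \<noteq> Xe"
    | (fin) "Y \<noteq> Xe" "t = fun_step (fin \<Sigma>) Xe"
    | (eps) "Y = Xe" "t = eps_step"
    using forms[OF t] eps_step_Xe t by fastforce
  then show "(Y, t) \<in> gr2pr_spec \<Sigma> G from_nat Xe"
  proof cases
    case ini
    then have "(root G, to_nat Z) \<in> edges G"
      using t X_neq_Xe by (auto simp: edge_iff)
    then have "(from_nat (root G), fun_step (ini \<Sigma>) (from_nat (to_nat Z)))
        \<in> gr2pr_spec \<Sigma> G from_nat Xe"
      by (rule gr2pr_specI)
    with ini show ?thesis by simp
  next
    case proper
    then have "(to_nat Y, to_nat Z) \<in> edges G" "vlab G (to_nat Y) = Some f"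
      using t lab by (auto simp: edge_iff)
    then have "(from_nat (to_nat Y), fun_step f (from_nat (to_nat Z)))
        \<in> gr2pr_spec \<Sigma> G from_nat Xe"
      using Y proper by (intro gr2pr_specI) auto
    with proper show ?thesis by simp
  next
    case pred
    have "(to_nat Y, to_nat Z) \<in> edges G" "(to_nat Y, to_nat Z') \<in> edges G"
      "vlab G (to_nat Y) = Some p"
      using t lab pred by (auto simp: edge_iff)
    moreover have "elab G (to_nat Y, to_nat Z) = Some 1" "elab G (to_nat Y, to_nat Z') = Some 0"
      using elab_pred_step t pred by metis+
    ultimately have "(from_nat (to_nat Y), pred_step p (from_nat (to_nat Z)) (from_nat (to_nat Z')))
        \<in> gr2pr_spec \<Sigma> G from_nat Xe"
      using Y pred by (intro gr2pr_specI) auto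
    with pred show ?thesis by simp
  next
    case fin
    then have "(from_nat (to_nat Y), fun_step (fin \<Sigma>) Xe) \<in> gr2pr_spec \<Sigma> G from_nat Xe"
      using Y lab by (intro gr2pr_specI) auto
    with fin show ?thesis by simp
  next
    case eps
    then show ?thesis by (simp add: gr2pr_spec_def)
  qed
next
  fix Y t assume "(Y, t) \<in> gr2pr_spec \<Sigma> G from_nat Xe"
  then show "(Y, t) \<in> S"
  proof (cases rule: gr2pr_spec_cases)
    case (ini w)
    from ini(3) obtain Z' u where "w = to_nat Z'" "(X, u) \<in> S" "Z' \<in> rvars u"
      by (auto elim: edgeE)
    with ini forms[of X u] X_neq_Xe show ?thesis by auto
  next
    case (proper v w f)
    from proper(6) obtain Y' Z u where "v = to_nat Y'" "w = to_nat Z" "Y' \<noteq> Xe"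
        "(Y', u) \<in> S" "Z \<in> rvars u"
      by (auto elim: edgeE)
    with proper forms[of Y' u] alphabet vlab_eq[of Y' u] show ?thesis
      by (auto simp: alphabet_def proper_funs_def)
  next
    case (pred v w w' p)
    from pred(6) obtain Y' Z where Z: "v = to_nat Y'" "w = to_nat Z" "Y' \<noteq> Xe" "Z \<noteq> Xe"
      by (auto elim: edgeE)
    from pred(7) obtain Z' where Z': "w' = to_nat Z'" "Z' \<noteq> Xe"
      by (auto elim: edgeE)
    \<comment> \<open>Each of the two edge labels yields an equation for \<open>Y'\<close> with one
      known branch; since \<open>Y'\<close> has only one equation, they fit together to
      \<open>pred_step q Z Z'\<close>.\<close>
    obtain q Z1 where q: "(Y', pred_step q Z Z1) \<in> S"
      using pred(8) Z by (auto simp: elab_eq split: if_splits)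
    obtain q' Z2 where "(Y', pred_step q' Z2 Z') \<in> S"
      using pred(9) Z Z' by (auto simp: elab_eq split: if_splits)
    then have "Z1 = Z'" using rhs_unique[OF q] by fastforce
    with pred Z Z' q vlab_eq[OF q] show ?thesis by simp
  next
    case (fin v)
    then obtain Y' where Y': "v = to_nat Y'" "Y' \<in> vars S" "Y' \<noteq> Xe" by auto
    obtain u where "(Y', u) \<in> S" using unique[OF Y'(2)] by blast
    with fin Y' forms[of Y' u] alphabet vlab_eq[of Y' u] show ?thesis
      by (auto simp: alphabet_def proper_funs_def)
  next
    case eps
    obtain u where "(Xe, u) \<in> S" using unique[OF Xe_var] by blast
    with eps_step_Xe eps show ?thesis by auto
  qed
qed

end

text \<open>Both the constructed graph and any competitor yield \<open>S\<close> itself for a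
  suitable choice of variables, the former through \<open>from_nat\<close>, the latter by undoing
  the renaming; equality of specifications then gives the isomorphism. The competitor may use any
  vertex type \<open>'v\<close>, so uniqueness is not restricted to graphs on
  \<open>nat\<close>.\<close>

theorem theorem3:
  fixes \<Sigma> :: "'a alphabet"
    and X :: "'x :: {countable, infinite}"
    and S :: "('a, 'x) spec"
  assumes "alphabet \<Sigma>"
    and "algorithm_process \<Sigma> (X, S)"
    and root_not_called: "\<forall>(Y, t)\<in>S. X \<notin> rvars t"
    and others_called: "\<forall>(Y, t)\<in>S. Y \<noteq> X \<and> t \<noteq> eps_step \<longrightarrow> (\<exists>(W, u)\<in>S. Y \<in> rvars u)"
    and branches_distinct: "\<forall>Y p Z Z'. (Y, pred_step p Z Z') \<in> S \<longrightarrow> Z \<noteq> Z'"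
    and no_pred_cycle: "acyclic {(Y, Z). \<exists>p Z1 Z2. (Y, pred_step p Z1 Z2) \<in> S \<and> Z \<in> {Z1, Z2}}"
  shows "\<exists>G :: (nat, 'a, nat) rld_graph.
    algorithm_graph \<Sigma> G \<and> rename_eq (X, S) (gr2pr \<Sigma> G) \<and>
    (\<forall>G' :: ('v, 'a, nat) rld_graph.
       algorithm_graph \<Sigma> G' \<and> rename_eq (X, S) (gr2pr \<Sigma> G') \<longrightarrow> isomorphic \<Sigma> G G')"
proof -
  have process: "recursive_spec S" "finite S" "X \<in> vars S"
    using assms(2) unfolding algorithm_process_def prod.case by blast+
  obtain Xe where "Xe \<in> vars S" and eqs: "\<And>Y t. (Y, t) \<in> S \<Longrightarrow>
      ((\<exists>Z\<in>vars S - {Xe}. t = fun_step (ini \<Sigma>) Z) \<or>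
       (\<exists>f\<in>proper_funs \<Sigma>. \<exists>Z\<in>vars S - {Xe}. t = fun_step f Z) \<or>
       (\<exists>p\<in>preds \<Sigma>. \<exists>Z\<in>vars S - {Xe}. \<exists>Z'\<in>vars S - {Xe}. t = pred_step p Z Z') \<or>
       t = fun_step (fin \<Sigma>) Xe \<or> t = eps_step) \<and>
      ((\<exists>Z\<in>vars S - {Xe}. t = fun_step (ini \<Sigma>) Z) \<longleftrightarrow> Y = X) \<and> (t = eps_step \<longleftrightarrow> Y = Xe)"
    using assms(2)[unfolded algorithm_process_def Let_def prod.case,
        THEN conjunct2, THEN conjunct2, THEN conjunct2]
    by (elim bexE) (rule that, assumption, drule (1) bspec, unfold prod.case, assumption)
  have unique: "\<And>Y. Y \<in> vars S \<Longrightarrow> \<exists>!t. (Y, t) \<in> S"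
    using process(1) unfolding recursive_spec_def by blast
  have root: "\<And>Y t. (Y, t) \<in> S \<Longrightarrow> X \<notin> rvars t"
    using root_not_called by blast
  have called: "\<And>Y t. (Y, t) \<in> S \<Longrightarrow> Y \<noteq> X \<Longrightarrow> t \<noteq> eps_step \<Longrightarrow>
      \<exists>(W, u)\<in>S. Y \<in> rvars u"
    using others_called by blast
  interpret called_process \<Sigma> X S Xe
  proof unfold_locales
    fix Y t assume "(Y, t) \<in> S"
    from eqs[OF this] show "(\<exists>Z\<in>vars S - {Xe}. Y = X \<and> t = fun_step (ini \<Sigma>) Z) \<or>
      (\<exists>f\<in>proper_funs \<Sigma>. \<exists>Z\<in>vars S - {Xe}. Y \<noteq> X \<and> t = fun_step f Z) \<or>
      (\<exists>p\<in>preds \<Sigma>. \<exists>Z\<in>vars S - {Xe}. \<exists>Z'\<in>vars S - {Xe}. Y \<noteq> X \<and> t = pred_step p Z Z') \<or>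
      (Y \<noteq> X \<and> t = fun_step (fin \<Sigma>) Xe) \<or>
      (Y = Xe \<and> Y \<noteq> X \<and> t = eps_step)"
      by (cases "Y = X") auto
  next
    fix t assume "(Xe, t) \<in> S"
    from eqs[OF this] show "t = eps_step" by blast
  qed (use assms(1) process(2,3) \<open>Xe \<in> vars S\<close> unique root called branches_distinct no_pred_cycle
      in \<open>blast+\<close>)
  interpret G: alg_graph \<Sigma> G
    by unfold_locales (fact alphabet algorithm_graph_process_graph)+
  have "rename_eq (X, S) (gr2pr \<Sigma> G)"
    using G.rename_eq_gr2pr[OF var_choice_process_graph] by (simp add: gr2pr_spec_process_graph)
  moreover have "isomorphic \<Sigma> G G'"
    if G': "algorithm_graph \<Sigma> G'" "rename_eq (X, S) (gr2pr \<Sigma> G')"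
    for G' :: "('v, 'a, nat) rld_graph"
  proof -
    interpret G': alg_graph \<Sigma> G'
      by unfold_locales (fact alphabet G'(1))+
    obtain \<xi> Xe' where "var_choice G' (\<xi>, Xe')" "S = gr2pr_spec \<Sigma> G' \<xi> Xe'"
      using G'.rename_eq_gr2prE[OF G'(2)] .
    then show ?thesis
      using isomorphic_if_same_spec[OF G.alg_graph_axioms G'.alg_graph_axioms
          var_choice_process_graph] gr2pr_spec_process_graph by simp
  qed
  ultimately show ?thesis
    using algorithm_graph_process_graph by blast
qed

end
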